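(* Let $A$ be a real $2\times2$ matrix, with $m_R,m_T,\theta_R,\theta_T,\rho_i,\tau_i,\lambda_i,\mu_i,\delta_R,\delta_T$ as defined in the context, and let $M_\gamma=\begin{pmatrix}\cos\gamma&-\sin\gamma\\ \sin\gamma&\cos\gamma\end{pmatrix}$. (i) If $\gamma=\theta_R$ and $A_{RC}=M_\gamma^{-1}AM_\gamma$, then $A_{RC}$ is in $\mathcal{R}$-centered form, and $A_{RC}=\begin{pmatrix}\rho_1&-m_T\\ m_T&\rho_2\end{pmatrix}$. (ii) If $\gamma=\theta_T$ and $A_{TC}=M_\gamma^{-1}AM_\gamma$, then $A_{TC}$ is in $\mathcal{T}$-centered form, and $A_{TC}=\begin{pmatrix}m_R&-\tau_2\\ \tau_1&m_R\end{pmatrix}$. (iii) When $A$ has real orthovalues $\mu_1>\mu_2$ with corresponding reactivity radius $\delta_R$, if $\gamma=\theta_R-\delta_R$ and $A_{RZ}=M_\gamma^{-1}AM_\gamma$, then $A_{RZ}$ is in $\mathcal{R}$-zeroed form, and $A_{RZ}=\begin{pmatrix}0&-\mu_2\\ \mu_1&2m_R\end{pmatrix}$. (iv) When $A$ has real eigenvalues $\lambda_1>\lambda_2$ with corresponding eigenvector separation radius $\delta_T$, if $\gamma=\theta_T-\delta_T$ and $A_{TZ}=M_\gamma^{-1}AM_\gamma$, then $A_{TZ}$ is in $\mathcal{T}$-zeroed form, and $A_{TZ}=\begin{pmatrix}\lambda_2&-2m_T\\0&\lambda_1\end{pmatrix}$.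
   Context: For $A=\begin{pmatrix} a_{11} & a_{12}\\ a_{21} & a_{22}\end{pmatrix}$ real put $m_R=\tfrac12(a_{11}+a_{22})$, $m_T=\tfrac12(a_{21}-a_{12})$, $p=\tfrac12\sqrt{(a_{11}-a_{22})^2+(a_{12}+a_{21})^2}$, $\theta_R=\tfrac12\arctan(a_{12}+a_{21},a_{11}-a_{22})\in\mathbb{R}\pmod\pi$ if $p\neq0$ (any value may be used if $p=0$), where $\arctan(y,x)\in\mathbb{R}\pmod{2\pi}$ is the polar angle of $(x,y)$, and $\theta_T=\theta_R-\pi/4\in\mathbb{R}\pmod\pi$. The radial and tangential functions of $A$ are $\mathcal{R}_A(\theta)=m_R+p\cos(2(\theta-\theta_R))$ and $\mathcal{T}_A(\theta)=m_T-p\sin(2(\theta-\theta_R))$; they attain their maxima at $\theta_R$ and $\theta_T$. Let $\rho_1=m_R+p$, $\rho_2=m_R-p$, $\tau_1=m_T+p$, $\tau_2=m_T-p$ be the maxima and minima of $\mathcal{R}_A$ and $\mathcal{T}_A$. Let $\lambda_1,\lambda_2$ be the eigenvalues of $A$. A nonzero $V\in\mathbb{R}^2$ is an orthovector of $A$ with orthovalue $\mu$ if $AV=\mu V^\perp$, where $V^\perp$ is $V$ rotated counter-clockwise by $\pi/2$; the orthovalues of $A$ are denoted $\mu_1,\mu_2$ (they are the eigenvalues of $-JA$ with $J=\begin{pmatrix}0&-1\\1&0\end{pmatrix}$). If $\mathcal{R}_A\not\equiv0$ has a zero, the reactivity radius $\delta_R\ge0$ is defined by $\mathcal{R}_A(\theta_R\pm\delta_R)=0$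 and $\mathcal{R}_A>0$ on $(\theta_R-\delta_R,\theta_R+\delta_R)\subset\mathbb{R}\pmod\pi$. If $\mathcal{T}_A\not\equiv0$ has a zero, the eigenvector separation radius $\delta_T\ge0$ is defined by $\mathcal{T}_A(\theta_T\pm\delta_T)=0$ and $\mathcal{T}_A>0$ on $(\theta_T-\delta_T,\theta_T+\delta_T)\subset\mathbb{R}\pmod\pi$. A real $2\times2$ matrix $B$ is in: $\mathcal{R}$-centered form if $\mathcal{R}_B(0)=\max\mathcal{R}_B$ (so $\mathcal{R}_B$ attains its maximum at $0$); $\mathcal{T}$-centered form if $\mathcal{T}_B(0)=\max\mathcal{T}_B$ (so $\mathcal{T}_B$ attains its maximum at $0$); $\mathcal{R}$-zeroed form if $\mathcal{R}_B(0)=0$ and $\mathcal{R}_B'(0)\ge0$; $\mathcal{T}$-zeroed form if $\mathcal{T}_B(0)=0$ and $\mathcal{T}_B'(0)\ge0$. *)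

theory Defs
  imports "HOL-Analysis.Analysis"
begin

definition mR :: "real^2^2 \<Rightarrow> real" where
  "mR A = (A$1$1 + A$2$2) / 2"

definition mT :: "real^2^2 \<Rightarrow> real" where
  "mT A = (A$2$1 - A$1$2) / 2"

definition amp :: "real^2^2 \<Rightarrow> real" where
  "amp A = sqrt ((A$1$1 - A$2$2)\<^sup>2 + (A$1$2 + A$2$1)\<^sup>2) / 2"

definition rho1 :: "real^2^2 \<Rightarrow> real" where "rho1 A = mR A + amp A"
definition rho2 :: "real^2^2 \<Rightarrow> real" where "rho2 A = mR A - amp A"
definition tau1 :: "real^2^2 \<Rightarrow> real" where "tau1 A = mT A + amp A"
definition tau2 :: "real^2^2 \<Rightarrow> real" where "tau2 A = mT A - amp A"

text \<open>
  The angle \<open>\<theta>\<^sub>R\<close> is half a polar angle of the vector \<open>(x, y)\<close> below, hence a class modulo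
  \<open>\<pi>\<close>. The predicate \<open>is_thetaR A\<close> holds of exactly the real representatives of that class;
  if the vector vanishes (that is, \<open>amp A = 0\<close>), \<open>is_Arg\<close> holds of every real number, so any
  angle is admitted. The function \<open>thetaR\<close> picks one representative; everything
  defined through it below does not depend on the choice.
\<close>

definition is_thetaR :: "real^2^2 \<Rightarrow> real \<Rightarrow> bool" where
  "is_thetaR A \<theta> \<longleftrightarrow> is_Arg (Complex (A$1$1 - A$2$2) (A$1$2 + A$2$1)) (2 * \<theta>)"

definition is_thetaT :: "real^2^2 \<Rightarrow> real \<Rightarrow> bool" where
  "is_thetaT A \<theta> \<longleftrightarrow> (\<exists>\<phi>. is_thetaR A \<phi> \<and> \<theta> = \<phi> - pi / 4)"

definition thetaR :: "real^2^2 \<Rightarrow> real" where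
  "thetaR A = Arg (Complex (A$1$1 - A$2$2) (A$1$2 + A$2$1)) / 2"

definition thetaT :: "real^2^2 \<Rightarrow> real" where
  "thetaT A = thetaR A - pi / 4"

definition radial :: "real^2^2 \<Rightarrow> real \<Rightarrow> real" where
  "radial A \<theta> = mR A + amp A * cos (2 * (\<theta> - thetaR A))"

definition tangential :: "real^2^2 \<Rightarrow> real \<Rightarrow> real" where
  "tangential A \<theta> = mT A - amp A * sin (2 * (\<theta> - thetaR A))"

definition is_eigenvalue :: "real^2^2 \<Rightarrow> real \<Rightarrow> bool" where
  "is_eigenvalue A l \<longleftrightarrow> (\<exists>V. V \<noteq> 0 \<and> A *v V = l *\<^sub>R V)"

definition perp :: "real^2 \<Rightarrow> real^2" where
  "perp V = vector [- V$2, V$1]"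

definition is_orthovalue :: "real^2^2 \<Rightarrow> real \<Rightarrow> bool" where
  "is_orthovalue A m \<longleftrightarrow> (\<exists>V. V \<noteq> 0 \<and> A *v V = m *\<^sub>R perp V)"

text \<open>
  The two radii are meaningful only when the function in question has a zero and is not
  identically zero; exactly one number then satisfies the description.
\<close>

definition reactivity_radius :: "real^2^2 \<Rightarrow> real" where
  "reactivity_radius A = (THE \<delta>. 0 \<le> \<delta> \<and>
     radial A (thetaR A + \<delta>) = 0 \<and> radial A (thetaR A - \<delta>) = 0 \<and>
     (\<forall>\<theta>\<in>{thetaR A - \<delta><..<thetaR A + \<delta>}. radial A \<theta> > 0))"

definition eigenvector_separation_radius :: "real^2^2 \<Rightarrow> real" where
  "eigenvector_separation_radius A = (THE \<delta>. 0 \<le> \<delta> \<and>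
     tangential A (thetaT A + \<delta>) = 0 \<and> tangential A (thetaT A - \<delta>) = 0 \<and>
     (\<forall>\<theta>\<in>{thetaT A - \<delta><..<thetaT A + \<delta>}. tangential A \<theta> > 0))"

definition rot :: "real \<Rightarrow> real^2^2" where
  "rot g = vector [vector [cos g, - sin g], vector [sin g, cos g]]"

definition rot_conj :: "real^2^2 \<Rightarrow> real \<Rightarrow> real^2^2" where
  "rot_conj A g = matrix_inv (rot g) ** A ** rot g"

definition R_centered :: "real^2^2 \<Rightarrow> bool" where
  "R_centered B \<longleftrightarrow> (\<forall>\<theta>. radial B \<theta> \<le> radial B 0)"

definition T_centered :: "real^2^2 \<Rightarrow> bool" where
  "T_centered B \<longleftrightarrow> (\<forall>\<theta>. tangential B \<theta> \<le> tangential B 0)"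

definition R_zeroed :: "real^2^2 \<Rightarrow> bool" where
  "R_zeroed B \<longleftrightarrow> radial B 0 = 0 \<and> deriv (radial B) 0 \<ge> 0"

definition T_zeroed :: "real^2^2 \<Rightarrow> bool" where
  "T_zeroed B \<longleftrightarrow> tangential B 0 = 0 \<and> deriv (tangential B) 0 \<ge> 0"

end

theory Submission
  imports Defs
begin

text \<open>
  Conjugating by a rotation through \<open>\<gamma>\<close> shifts the radial and tangential functions by \<open>\<gamma>\<close> and keeps
  \<open>mR\<close>, \<open>mT\<close> and \<open>amp\<close>; explicitly, the entries of the conjugate are \<open>mR \<plusminus> p cos (2(\<gamma> - \<theta>R))\<close> and
  \<open>\<plusminus>mT - p sin (2(\<gamma> - \<theta>R))\<close>, where \<open>p = amp A\<close>. The orthovalues are \<open>mT \<plusminus> sqrt (p\<^sup>2 - mR\<^sup>2)\<close> and the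
  eigenvalues \<open>mR \<plusminus> sqrt (p\<^sup>2 - mT\<^sup>2)\<close>. When they are real and distinct, the function in question
  has, up to a shift, the form \<open>m + p cos (2t)\<close> with \<open>\<bar>m\<bar> < p\<close>, so the radius is \<open>\<delta> = arccos (-m/p) / 2\<close>, and
  \<open>p cos (2\<delta>) = -m\<close>, \<open>p sin (2\<delta>) = sqrt (p\<^sup>2 - m\<^sup>2)\<close> are the quantities that occur in the entries.
\<close>

section \<open>Polar form of the entries and of the radial and tangential functions\<close>

lemma is_thetaR_iff:
  "is_thetaR A \<theta> \<longleftrightarrow>
     A$1$1 - A$2$2 = 2 * amp A * cos (2 * \<theta>) \<and> A$1$2 + A$2$1 = 2 * amp A * sin (2 * \<theta>)"
  by (simp add: is_thetaR_def is_Arg_def complex_eq_iff amp_def cmod_def Re_exp Im_exp)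

lemma is_thetaR_thetaR: "is_thetaR A (thetaR A)"
  by (cases "Complex (A$1$1 - A$2$2) (A$1$2 + A$2$1) = 0")
     (auto simp: is_thetaR_def thetaR_def is_Arg_def is_Arg_Arg Arg_eq)

lemma entries_polar:
  assumes "is_thetaR A \<theta>"
  shows "A$1$1 = mR A + amp A * cos (2 * \<theta>)" "A$2$2 = mR A - amp A * cos (2 * \<theta>)"
    "A$1$2 = amp A * sin (2 * \<theta>) - mT A" "A$2$1 = amp A * sin (2 * \<theta>) + mT A"
  using assms by (auto simp: is_thetaR_iff mR_def mT_def field_simps)

lemma amp_nonneg [simp]: "0 \<le> amp A"
  by (simp add: amp_def)

lemma amp_squared: "(amp A)\<^sup>2 = ((A$1$1 - A$2$2)\<^sup>2 + (A$1$2 + A$2$1)\<^sup>2) / 4"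
  by (simp add: amp_def power_divide)

text \<open>Expanding the cosine removes \<open>thetaR\<close>. The value and the derivative at 0
  can then be read off the entries, so the forms of a conjugate are checked without finding its own
  \<open>thetaR\<close>.\<close>

lemma radial_eq:
  "radial A \<theta> = mR A + ((A$1$1 - A$2$2) * cos (2 * \<theta>) + (A$1$2 + A$2$1) * sin (2 * \<theta>)) / 2"
  using is_thetaR_thetaR[of A]
  by (simp add: is_thetaR_iff radial_def right_diff_distrib cos_diff field_simps)

lemma tangential_eq:
  "tangential A \<theta> = mT A - ((A$1$1 - A$2$2) * sin (2 * \<theta>) - (A$1$2 + A$2$1) * cos (2 * \<theta>)) / 2"
  using is_thetaR_thetaR[of A]
  by (simp add: is_thetaR_iff tangential_def right_diff_distrib sin_diff field_simps)

lemma radial_0 [simp]: "radial A 0 = A$1$1"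
  by (simp add: radial_eq mR_def field_simps)

lemma tangential_0 [simp]: "tangential A 0 = A$2$1"
  by (simp add: tangential_eq mT_def field_simps)

lemma deriv_radial_0: "deriv (radial A) 0 = A$1$2 + A$2$1"
proof (rule DERIV_imp_deriv)
  show "(radial A has_field_derivative A$1$2 + A$2$1) (at 0)"
    unfolding radial_eq[abs_def] by (auto intro!: derivative_eq_intros)
qed

lemma deriv_tangential_0: "deriv (tangential A) 0 = A$2$2 - A$1$1"
proof (rule DERIV_imp_deriv)
  show "(tangential A has_field_derivative A$2$2 - A$1$1) (at 0)"
    unfolding tangential_eq[abs_def] by (auto intro!: derivative_eq_intros simp: field_simps)
qed

lemma R_centeredI:
  assumes "B$1$1 = rho1 B"
  shows "R_centered B"
  unfolding R_centered_def radial_0 assms unfolding rho1_def radial_def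
  using mult_left_le[OF cos_le_one amp_nonneg] by simp

lemma T_centeredI:
  assumes "B$2$1 = tau1 B"
  shows "T_centered B"
proof -
  have "- (amp B * sin t) \<le> amp B" for t
    using mult_left_le[OF _ amp_nonneg, of "- sin t" B] sin_ge_minus_one[of t] by simp
  then show ?thesis
    unfolding T_centered_def tangential_0 assms unfolding tau1_def tangential_def by (smt (verit))
qed

section \<open>Conjugation by a rotation\<close>

lemma matrix_inv_rot: "matrix_inv (rot g) = rot (- g)"
  unfolding matrix_inv_def
\<comment> \<open>\<open>matrix_inv\<close> is a choice among two-sided inverses, so uniqueness is
  needed as well.\<close>
proof (rule some_equality)
  show inv: "rot g ** rot (- g) = mat 1 \<and> rot (- g) ** rot g = mat 1"
    by (simp add: rot_def vec_eq_iff forall_2 matrix_matrix_mult_def sum_2 mat_def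
        flip: power2_eq_square)
  show "B = rot (- g)" if "rot g ** B = mat 1 \<and> B ** rot g = mat 1" for B
    using that inv by (metis matrix_mul_assoc matrix_mul_lid matrix_mul_rid)
qed

text \<open>The scalar and antisymmetric parts of \<open>A\<close> commute with rotations; the
  traceless symmetric part, with polar angle \<open>2 * \<theta>\<close>, is turned by
  \<open>- 2 * \<gamma>\<close>.\<close>

lemma rot_conj_polar:
  assumes "is_thetaR A \<theta>"
  shows "rot_conj A \<gamma> =
    vector [vector [mR A + amp A * cos (2 * (\<gamma> - \<theta>)), - mT A - amp A * sin (2 * (\<gamma> - \<theta>))],
            vector [mT A - amp A * sin (2 * (\<gamma> - \<theta>)), mR A - amp A * cos (2 * (\<gamma> - \<theta>))]]"
proof -
  \<comment> \<open>With \<open>c\<close>, \<open>s\<close> and \<open>one\<close> the claim becomes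
    a polynomial identity in the sines and cosines of \<open>\<gamma>\<close> and
    \<open>2 * \<theta>\<close>.\<close>
  have c: "cos (2 * (\<gamma> - \<theta>)) = ((cos \<gamma>)\<^sup>2 - (sin \<gamma>)\<^sup>2) * cos (2 * \<theta>) + 2 * sin \<gamma> * cos \<gamma> * sin (2 * \<theta>)"
    by (simp only: right_diff_distrib cos_diff) (simp only: cos_double sin_double)
  have s: "sin (2 * (\<gamma> - \<theta>)) = 2 * sin \<gamma> * cos \<gamma> * cos (2 * \<theta>) - ((cos \<gamma>)\<^sup>2 - (sin \<gamma>)\<^sup>2) * sin (2 * \<theta>)"
    by (simp only: right_diff_distrib sin_diff) (simp only: cos_double sin_double)
  have one: "(cos \<gamma>)\<^sup>2 = 1 - (sin \<gamma>)\<^sup>2" by (rule cos_squared_eq)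
  have "rot_conj A \<gamma> = vector
    [vector [cos \<gamma> * (A$1$1 * cos \<gamma> + A$1$2 * sin \<gamma>) + sin \<gamma> * (A$2$1 * cos \<gamma> + A$2$2 * sin \<gamma>),
             cos \<gamma> * (A$1$2 * cos \<gamma> - A$1$1 * sin \<gamma>) + sin \<gamma> * (A$2$2 * cos \<gamma> - A$2$1 * sin \<gamma>)],
     vector [cos \<gamma> * (A$2$1 * cos \<gamma> + A$2$2 * sin \<gamma>) - sin \<gamma> * (A$1$1 * cos \<gamma> + A$1$2 * sin \<gamma>),
             cos \<gamma> * (A$2$2 * cos \<gamma> - A$2$1 * sin \<gamma>) - sin \<gamma> * (A$1$2 * cos \<gamma> - A$1$1 * sin \<gamma>)]]"
    unfolding rot_conj_def matrix_inv_rot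
    by (simp add: rot_def vec_eq_iff forall_2 matrix_matrix_mult_def sum_2 algebra_simps)
  also have "\<dots> = vector [vector [mR A + amp A * cos (2 * (\<gamma> - \<theta>)), - mT A - amp A * sin (2 * (\<gamma> - \<theta>))],
            vector [mT A - amp A * sin (2 * (\<gamma> - \<theta>)), mR A - amp A * cos (2 * (\<gamma> - \<theta>))]]"
    unfolding c s entries_polar[OF assms] vec_eq_iff forall_2 vector_2
    using one by (intro conjI; algebra)
  finally show ?thesis .
qed

section \<open>Orthovalues and eigenvalues as roots of quadratics\<close>

lemma singular_2:
  fixes a b c d x y :: real
  assumes "a * x + b * y = 0" "c * x + d * y = 0" "x \<noteq> 0 \<or> y \<noteq> 0"
  shows "a * d - b * c = 0"
proof -
  have "(a * d - b * c) * x = 0" "(a * d - b * c) * y = 0"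
    using assms(1,2) by algebra+
  then show ?thesis using assms(3) by auto
qed

text \<open>An orthovector lies in the kernel of a matrix with determinant
  \<open>\<mu>^2 - 2 * mT A * \<mu> + det A\<close>. Completing the square uses
  \<open>det A = (mR A)^2 + (mT A)^2 - (amp A)^2\<close>; for eigenvalues \<open>mR\<close> and
  \<open>mT\<close> trade places.\<close>

lemma orthovalue_squared:
  assumes "is_orthovalue A \<mu>"
  shows "(\<mu> - mT A)\<^sup>2 = (amp A)\<^sup>2 - (mR A)\<^sup>2"
proof -
  obtain V where V: "V \<noteq> 0" "A *v V = \<mu> *\<^sub>R perp V"
    using assms by (auto simp: is_orthovalue_def)
  then have "A$1$1 * V$1 + (A$1$2 + \<mu>) * V$2 = 0" "(A$2$1 - \<mu>) * V$1 + A$2$2 * V$2 = 0"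
    by (simp_all add: vec_eq_iff forall_2 matrix_vector_mult_def sum_2 perp_def algebra_simps)
  moreover have "V$1 \<noteq> 0 \<or> V$2 \<noteq> 0" using V by (simp add: vec_eq_iff forall_2)
  ultimately have "A$1$1 * A$2$2 - (A$1$2 + \<mu>) * (A$2$1 - \<mu>) = 0" by (rule singular_2)
  then show ?thesis
    unfolding amp_squared mR_def mT_def by (simp add: power2_eq_square field_simps)
qed

lemma eigenvalue_squared:
  assumes "is_eigenvalue A l"
  shows "(l - mR A)\<^sup>2 = (amp A)\<^sup>2 - (mT A)\<^sup>2"
proof -
  obtain V where V: "V \<noteq> 0" "A *v V = l *\<^sub>R V"
    using assms by (auto simp: is_eigenvalue_def)
  then have "(A$1$1 - l) * V$1 + A$1$2 * V$2 = 0" "A$2$1 * V$1 + (A$2$2 - l) * V$2 = 0"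
    by (simp_all add: vec_eq_iff forall_2 matrix_vector_mult_def sum_2 algebra_simps)
  moreover have "V$1 \<noteq> 0 \<or> V$2 \<noteq> 0" using V by (simp add: vec_eq_iff forall_2)
  ultimately have "(A$1$1 - l) * (A$2$2 - l) - A$1$2 * A$2$1 = 0" by (rule singular_2)
  then show ?thesis
    unfolding amp_squared mR_def mT_def by (simp add: power2_eq_square field_simps)
qed

text \<open>Distinct numbers with equal squares are opposite, and the larger is positive. The
  radicand is therefore positive, which yields the strict bound that makes the radius well
  defined.\<close>

lemma two_square_roots:
  fixes x y m p n :: real
  assumes "(x - m)\<^sup>2 = p\<^sup>2 - n\<^sup>2" "(y - m)\<^sup>2 = p\<^sup>2 - n\<^sup>2" "x > y" "0 \<le> p"
  shows "x = m + sqrt (p\<^sup>2 - n\<^sup>2)" "y = m - sqrt (p\<^sup>2 - n\<^sup>2)" "\<bar>n\<bar> < p"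
proof -
  have "x - m = y - m \<or> x - m = - (y - m)"
    using assms(1,2) by (metis power2_eq_iff)
  then have xy: "x - m = - (y - m)" "x - m > 0" using assms(3) by auto
  then show "x = m + sqrt (p\<^sup>2 - n\<^sup>2)" "y = m - sqrt (p\<^sup>2 - n\<^sup>2)"
    by (simp_all flip: assms(1))
  have "n\<^sup>2 < p\<^sup>2" using xy assms(1) by (smt (verit) zero_less_power2)
  then show "\<bar>n\<bar> < p" using assms(4) by (simp add: power2_less_imp_less)
qed

section \<open>The radii\<close>

lemma the_radius_cos:
  fixes f :: "real \<Rightarrow> real"
  assumes f: "\<And>t. f (c + t) = m + p * cos (2 * t)" and mp: "\<bar>m\<bar> < p"
  defines "\<delta> \<equiv> (THE \<delta>. 0 \<le> \<delta> \<and> f (c + \<delta>) = 0 \<and> f (c - \<delta>) = 0 \<and>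
                  (\<forall>\<theta>\<in>{c - \<delta><..<c + \<delta>}. f \<theta> > 0))"
  shows "p * cos (2 * \<delta>) = - m" "p * sin (2 * \<delta>) = sqrt (p\<^sup>2 - m\<^sup>2)"
proof -
  define d where "d = arccos (- m / p) / 2"
  have p: "p > 0" and mp1: "- 1 \<le> - m / p" "- m / p \<le> 1"
    using mp by (auto simp: field_simps)
  have d2: "2 * d = arccos (- m / p)" by (simp add: d_def)
  have d: "0 \<le> d" "2 * d \<le> pi" using mp1 by (simp_all add: d2 arccos_ubound d_def arccos_lbound)
  have cosd: "p * cos (2 * d) = - m" using p mp1 by (simp add: d2)
  have pos: "f \<theta> > 0" if "\<theta> \<in> {c - d<..<c + d}" for \<theta>
  proof -
    define t where "t = \<theta> - c"
    \<comment> \<open>Cosine is even and strictly decreasing on \<open>[0, pi]\<close>, which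
      contains \<open>2 * d\<close>.\<close>
    have "cos (2 * d) < cos \<bar>2 * t\<bar>"
      using that d by (intro cos_monotone_0_pi) (auto simp: t_def)
    then have "p * cos (2 * d) < p * cos (2 * t)" using p by simp
    then show ?thesis using f[of t] cosd by (simp add: t_def)
  qed
  have zero: "f (c + d) = 0" "f (c - d) = 0"
    using f[of d] f[of "- d"] cosd by simp_all
  have "\<delta> = d"
    unfolding \<delta>_def
  proof (rule the_equality)
    show "0 \<le> d \<and> f (c + d) = 0 \<and> f (c - d) = 0 \<and> (\<forall>\<theta>\<in>{c - d<..<c + d}. f \<theta> > 0)"
      using d zero pos by blast
  next
    fix e assume e: "0 \<le> e \<and> f (c + e) = 0 \<and> f (c - e) = 0 \<and> (\<forall>\<theta>\<in>{c - e<..<c + e}. f \<theta> > 0)"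
    \<comment> \<open>A larger radius would enclose the zero at \<open>c + d\<close>; a smaller one
      would put a zero where \<open>f\<close> is positive.\<close>
    have "\<not> d < e" using e zero d by (auto dest!: bspec[where x = "c + d"])
    moreover have "\<not> e < d" using e pos[of "c + e"] by auto
    ultimately show "e = d" by simp
  qed
  then show "p * cos (2 * \<delta>) = - m" using cosd by simp
  have "p * sin (2 * d) = p * sqrt (1 - (m / p)\<^sup>2)"
    using mp1 by (simp add: d2 sin_arccos)
  also have "\<dots> = sqrt (p\<^sup>2 * (1 - (m / p)\<^sup>2))" using p by (simp add: real_sqrt_mult)
  also have "p\<^sup>2 * (1 - (m / p)\<^sup>2) = p\<^sup>2 - m\<^sup>2" using p by (simp add: field_simps)
  finally show "p * sin (2 * \<delta>) = sqrt (p\<^sup>2 - m\<^sup>2)" using \<open>\<delta> = d\<close> by simp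
qed

lemma reactivity_radius:
  assumes "\<bar>mR A\<bar> < amp A"
  shows "amp A * cos (2 * reactivity_radius A) = - mR A"
    "amp A * sin (2 * reactivity_radius A) = sqrt ((amp A)\<^sup>2 - (mR A)\<^sup>2)"
  unfolding reactivity_radius_def
  by (rule the_radius_cos; simp add: radial_def assms)+

lemma eigenvector_separation_radius:
  assumes "\<bar>mT A\<bar> < amp A"
  shows "amp A * cos (2 * eigenvector_separation_radius A) = - mT A"
    "amp A * sin (2 * eigenvector_separation_radius A) = sqrt ((amp A)\<^sup>2 - (mT A)\<^sup>2)"
proof -
  have "tangential A (thetaT A + t) = mT A + amp A * cos (2 * t)" for t
  proof -
    \<comment> \<open>The shift by \<open>pi / 4\<close> turns \<open>- sin\<close> into
      \<open>cos\<close>, so the radial argument applies about \<open>thetaT A\<close>.\<close>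
    have "2 * (thetaT A + t - thetaR A) = 2 * t - pi / 2" by (simp add: thetaT_def)
    then show ?thesis unfolding tangential_def by (simp only:) (simp add: sin_diff)
  qed
  from the_radius_cos[of "tangential A", OF this assms]
  show "amp A * cos (2 * eigenvector_separation_radius A) = - mT A"
    "amp A * sin (2 * eigenvector_separation_radius A) = sqrt ((amp A)\<^sup>2 - (mT A)\<^sup>2)"
    unfolding eigenvector_separation_radius_def by blast+
qed

section \<open>The four normal forms\<close>

lemma rot_conj_thetaR:
  assumes "is_thetaR A \<gamma>"
  shows "R_centered (rot_conj A \<gamma>)"
    "rot_conj A \<gamma> = vector [vector [rho1 A, - mT A], vector [mT A, rho2 A]]"
proof -
  show eq: "rot_conj A \<gamma> = vector [vector [rho1 A, - mT A], vector [mT A, rho2 A]]"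
    by (simp add: rot_conj_polar[OF assms] rho1_def rho2_def)
  \<comment> \<open>The entries in \<open>eq\<close> show that the conjugate has the same
    \<open>mR\<close> and \<open>amp\<close> as \<open>A\<close>, hence the same
    \<open>rho1\<close>.\<close>
  show "R_centered (rot_conj A \<gamma>)"
    by (rule R_centeredI, unfold eq) (simp add: rho1_def rho2_def mR_def amp_def)
qed

lemma rot_conj_thetaT:
  assumes "is_thetaT A \<gamma>"
  shows "T_centered (rot_conj A \<gamma>)"
    "rot_conj A \<gamma> = vector [vector [mR A, - tau2 A], vector [tau1 A, mR A]]"
proof -
  obtain \<theta> where \<theta>: "is_thetaR A \<theta>" "\<gamma> = \<theta> - pi / 4"
    using assms by (auto simp: is_thetaT_def)
  show eq: "rot_conj A \<gamma> = vector [vector [mR A, - tau2 A], vector [tau1 A, mR A]]"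
    \<comment> \<open>Here the doubled angle is \<open>- pi / 2\<close>: the cosine vanishes and the
      sine is -1.\<close>
    by (simp add: rot_conj_polar[OF \<theta>(1)] \<theta>(2) tau1_def tau2_def)
  show "T_centered (rot_conj A \<gamma>)"
    by (rule T_centeredI, unfold eq) (simp add: tau1_def tau2_def mT_def amp_def)
qed

text \<open>The doubled angle is minus twice the radius: its cosine cancels \<open>mR A\<close> in
  the first entry, and its negative sine puts the larger orthovalue at the lower left.\<close>

lemma rot_conj_thetaR_minus_radius:
  assumes "is_orthovalue A \<mu>1" "is_orthovalue A \<mu>2" "\<mu>1 > \<mu>2" "is_thetaR A \<theta>"
  shows "R_zeroed (rot_conj A (\<theta> - reactivity_radius A))"
    "rot_conj A (\<theta> - reactivity_radius A) = vector [vector [0, - \<mu>2], vector [\<mu>1, 2 * mR A]]"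
proof -
  note roots = two_square_roots[OF orthovalue_squared[OF assms(1)] orthovalue_squared[OF assms(2)]
      assms(3) amp_nonneg]
  show eq: "rot_conj A (\<theta> - reactivity_radius A) = vector [vector [0, - \<mu>2], vector [\<mu>1, 2 * mR A]]"
    by (simp add: rot_conj_polar[OF assms(4)] reactivity_radius[OF roots(3)] roots(1,2))
  show "R_zeroed (rot_conj A (\<theta> - reactivity_radius A))"
    \<comment> \<open>The derivative at 0 is \<open>\<mu>1 - \<mu>2\<close>.\<close>
    unfolding R_zeroed_def deriv_radial_0 radial_0 eq using assms(3) by simp
qed

lemma rot_conj_thetaT_minus_radius:
  assumes "is_eigenvalue A l1" "is_eigenvalue A l2" "l1 > l2" "is_thetaT A \<theta>"
  shows "T_zeroed (rot_conj A (\<theta> - eigenvector_separation_radius A))"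
    "rot_conj A (\<theta> - eigenvector_separation_radius A) = vector [vector [l2, - 2 * mT A], vector [0, l1]]"
proof -
  let ?d = "eigenvector_separation_radius A"
  obtain \<phi> where \<phi>: "is_thetaR A \<phi>" "\<theta> = \<phi> - pi / 4"
    using assms(4) by (auto simp: is_thetaT_def)
  note roots = two_square_roots[OF eigenvalue_squared[OF assms(1)] eigenvalue_squared[OF assms(2)]
      assms(3) amp_nonneg]
  have "2 * (\<theta> - ?d - \<phi>) = - (2 * ?d + pi / 2)" by (simp add: \<phi>(2))
  \<comment> \<open>The extra quarter turn swaps the roles: the square root now enters the diagonal,
    giving the eigenvalues, and \<open>mT A\<close> cancels at the lower left.\<close>
  then have trig: "cos (2 * (\<theta> - ?d - \<phi>)) = - sin (2 * ?d)" "sin (2 * (\<theta> - ?d - \<phi>)) = - cos (2 * ?d)"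
    by (simp_all only: cos_minus sin_minus cos_add sin_add) simp_all
  show eq: "rot_conj A (\<theta> - ?d) = vector [vector [l2, - 2 * mT A], vector [0, l1]]"
    unfolding rot_conj_polar[OF \<phi>(1)] trig
    by (simp add: eigenvector_separation_radius[OF roots(3)] roots(1,2))
  show "T_zeroed (rot_conj A (\<theta> - ?d))"
    \<comment> \<open>The derivative at 0 is \<open>l1 - l2\<close>.\<close>
    unfolding T_zeroed_def deriv_tangential_0 tangential_0 eq using assms(3) by simp
qed

theorem theorem6p3:
  fixes A :: "real^2^2"
  shows "(\<forall>\<gamma>. is_thetaR A \<gamma> \<longrightarrow>
            R_centered (rot_conj A \<gamma>) \<and>
            rot_conj A \<gamma> = vector [vector [rho1 A, - mT A], vector [mT A, rho2 A]])
       \<and> (\<forall>\<gamma>. is_thetaT A \<gamma> \<longrightarrow>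
            T_centered (rot_conj A \<gamma>) \<and>
            rot_conj A \<gamma> = vector [vector [mR A, - tau2 A], vector [tau1 A, mR A]])
       \<and> (\<forall>\<mu>1 \<mu>2 \<theta>R \<gamma>. is_orthovalue A \<mu>1 \<and> is_orthovalue A \<mu>2 \<and> \<mu>1 > \<mu>2 \<and>
            is_thetaR A \<theta>R \<and> \<gamma> = \<theta>R - reactivity_radius A \<longrightarrow>
            R_zeroed (rot_conj A \<gamma>) \<and>
            rot_conj A \<gamma> = vector [vector [0, - \<mu>2], vector [\<mu>1, 2 * mR A]])
       \<and> (\<forall>l1 l2 \<theta>T \<gamma>. is_eigenvalue A l1 \<and> is_eigenvalue A l2 \<and> l1 > l2 \<and>
            is_thetaT A \<theta>T \<and> \<gamma> = \<theta>T - eigenvector_separation_radius A \<longrightarrow>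
            T_zeroed (rot_conj A \<gamma>) \<and>
            rot_conj A \<gamma> = vector [vector [l2, - 2 * mT A], vector [0, l1]])"
  by (intro conjI allI impI;
      metis rot_conj_thetaR rot_conj_thetaT rot_conj_thetaR_minus_radius rot_conj_thetaT_minus_radius)

end
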